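(* Given an $n$-vertex graph $G$, we can construct in polynomial time another graph $H$ on $n^3 + n$ vertices such that $G$ has a vertex cover of size $c$ if and only if $H$ has a fill-in of size at most $(c+1)n^2 - 1$.
   Context: All graphs are undirected and simple. A vertex cover of a graph $G$ is a set of vertices such that every edge of $G$ has at least one end in the set. A graph is chordal if it has no induced cycle of length at least four. A fill-in of a graph $H$ is a set $E_+$ of non-edges of $H$ such that $H + E_+$ (the graph with vertex set $V(H)$ and edge set $E(H)\cup E_+$) is chordal.
   Formalization: The formal statement assumes that G has at least one vertex and that c is at most n; for c > n ≥ 1 no vertex cover of size c exists although H has a fill-in within the bound, and for n = 0 the bound is −1, so the claim fails there. *)

theory Defs
  imports Main "HOL-Computational_Algebra.Polynomial"
begin

section \<open>Graphs\<close>

text \<open>A graph is given by its vertex set and its edge set; an edge is a two-element set of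
  vertices.\<close>

definition simple_graph :: "'a set \<Rightarrow> 'a set set \<Rightarrow> bool" where
  "simple_graph V E \<longleftrightarrow> finite V \<and> (\<forall>e\<in>E. e \<subseteq> V \<and> card e = 2)"

definition vertex_cover :: "'a set \<Rightarrow> 'a set set \<Rightarrow> 'a set \<Rightarrow> bool" where
  "vertex_cover V E C \<longleftrightarrow> C \<subseteq> V \<and> (\<forall>e\<in>E. e \<inter> C \<noteq> {})"

text \<open>A cycle is represented by the list of its vertices in cyclic order.\<close>

definition cycle_edges :: "'a list \<Rightarrow> 'a set set" where
  "cycle_edges xs = {{xs ! i, xs ! (Suc i mod length xs)} | i. i < length xs}"

definition induced_cycle :: "'a set \<Rightarrow> 'a set set \<Rightarrow> 'a list \<Rightarrow> bool" where
  "induced_cycle V E xs \<longleftrightarrow>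
     3 \<le> length xs \<and> distinct xs \<and> set xs \<subseteq> V \<and> {e \<in> E. e \<subseteq> set xs} = cycle_edges xs"

definition chordal :: "'a set \<Rightarrow> 'a set set \<Rightarrow> bool" where
  "chordal V E \<longleftrightarrow> \<not> (\<exists>xs. induced_cycle V E xs \<and> 4 \<le> length xs)"

definition non_edges :: "'a set \<Rightarrow> 'a set set \<Rightarrow> 'a set set" where
  "non_edges V E = {e. e \<subseteq> V \<and> card e = 2} - E"

definition fill_in :: "'a set \<Rightarrow> 'a set set \<Rightarrow> 'a set set \<Rightarrow> bool" where
  "fill_in V E F \<longleftrightarrow> F \<subseteq> non_edges V E \<and> chordal V (E \<union> F)"


section \<open>Random access machines\<close>

text \<open>The random access machine of Cook and Reckhow (Time bounded random access machines, 1973),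
  over natural numbers with truncated subtraction: registers \<open>X\<^sub>0, X\<^sub>1, \<dots>\<close>, direct and
  indirect addressing, a read-only input and a write-only output. Every instruction costs one time
  unit. As there is no multiplication, a register grows by at most one bit per step, so
  this cost measure is polynomially related to time on multitape Turing machines.\<close>

datatype instr =
    SetConst nat nat      \<comment> \<open>\<open>SetConst i c\<close>: \<open>X\<^sub>i := c\<close>\<close>
  | Add nat nat nat       \<comment> \<open>\<open>Add i j k\<close>: \<open>X\<^sub>i := X\<^sub>j + X\<^sub>k\<close>\<close>
  | Sub nat nat nat       \<comment> \<open>\<open>Sub i j k\<close>: \<open>X\<^sub>i := X\<^sub>j - X\<^sub>k\<close>, truncated at 0\<close>
  | Load nat nat          \<comment> \<open>\<open>Load i j\<close>: \<open>X\<^sub>i\<close> := the register with index \<open>X\<^sub>j\<close>\<close>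
  | Store nat nat         \<comment> \<open>\<open>Store i j\<close>: the register with index \<open>X\<^sub>i\<close> := \<open>X\<^sub>j\<close>\<close>
  | JumpPos nat nat       \<comment> \<open>\<open>JumpPos l j\<close>: continue at instruction \<open>l\<close> if \<open>X\<^sub>j > 0\<close>\<close>
  | Read nat              \<comment> \<open>\<open>Read i\<close>: \<open>X\<^sub>i\<close> := next input number, 0 if there is none\<close>
  | Print nat             \<comment> \<open>\<open>Print i\<close>: append \<open>X\<^sub>i\<close> to the output\<close>

record ram_config =
  pc :: nat
  reg :: "nat \<Rightarrow> nat"
  inp :: "nat list"
  outp :: "nat list"

fun ram_exec :: "instr \<Rightarrow> ram_config \<Rightarrow> ram_config" where
  "ram_exec (SetConst i c) s = s\<lparr>pc := Suc (pc s), reg := (reg s)(i := c)\<rparr>"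
| "ram_exec (Add i j k) s = s\<lparr>pc := Suc (pc s), reg := (reg s)(i := reg s j + reg s k)\<rparr>"
| "ram_exec (Sub i j k) s = s\<lparr>pc := Suc (pc s), reg := (reg s)(i := reg s j - reg s k)\<rparr>"
| "ram_exec (Load i j) s = s\<lparr>pc := Suc (pc s), reg := (reg s)(i := reg s (reg s j))\<rparr>"
| "ram_exec (Store i j) s = s\<lparr>pc := Suc (pc s), reg := (reg s)(reg s i := reg s j)\<rparr>"
| "ram_exec (JumpPos l j) s = s\<lparr>pc := (if reg s j > 0 then l else Suc (pc s))\<rparr>"
| "ram_exec (Read i) s =
     s\<lparr>pc := Suc (pc s), reg := (reg s)(i := (case inp s of [] \<Rightarrow> 0 | x # _ \<Rightarrow> x)), inp := tl (inp s)\<rparr>"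
| "ram_exec (Print i) s = s\<lparr>pc := Suc (pc s), outp := outp s @ [reg s i]\<rparr>"

text \<open>The machine halts when the program counter leaves the program; a halted configuration no
  longer changes.\<close>

definition ram_halted :: "instr list \<Rightarrow> ram_config \<Rightarrow> bool" where
  "ram_halted P s \<longleftrightarrow> length P \<le> pc s"

definition ram_step :: "instr list \<Rightarrow> ram_config \<Rightarrow> ram_config" where
  "ram_step P s = (if ram_halted P s then s else ram_exec (P ! pc s) s)"

definition ram_init :: "nat list \<Rightarrow> ram_config" where
  "ram_init x = \<lparr>pc = 0, reg = (\<lambda>_. 0), inp = x, outp = []\<rparr>"

definition ram_outputs_within :: "instr list \<Rightarrow> nat list \<Rightarrow> nat \<Rightarrow> nat list \<Rightarrow> bool" where
  "ram_outputs_within P x t y \<longleftrightarrow>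
     (let s = (ram_step P ^^ t) (ram_init x) in ram_halted P s \<and> outp s = y)"

text \<open>The machine encoding of a graph whose vertices are listed as \<open>vs\<close>: the number of vertices,
  followed by the adjacency matrix in row-major order.\<close>

definition graph_encoding :: "'a list \<Rightarrow> 'a set set \<Rightarrow> nat list" where
  "graph_encoding vs E =
     length vs # concat (map (\<lambda>u. map (\<lambda>v. if {u, v} \<in> E then 1 else 0) vs) vs)"

end

theory Submission
  imports Defs
begin

text \<open>Add to \<open>G\<close> a clique of \<open>n ^ 3\<close> vertices, split into \<open>n\<close> groups of \<open>n ^ 2\<close> guards, one group
  per vertex of \<open>G\<close>, and join every vertex to all guards but its own. If \<open>u v\<close> is an edge of \<open>G\<close>, then
  \<open>u, v\<close>, a guard of \<open>u\<close> and a guard of \<open>v\<close> form a 4-cycle whose chords join a vertex to one of its own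
  guards. Hence the vertices that a fill-in joins to all their guards form a vertex cover, and each of
  them costs \<open>n ^ 2\<close> edges. Conversely, joining the vertices of a cover \<open>C\<close> to their guards and to each
  other yields a split graph, and the edges inside \<open>C\<close> number less than \<open>n ^ 2\<close>.\<close>

section \<open>Chordal graphs\<close>

text \<open>Otherwise 2 would agree with 1 or -1 modulo the length of the list, which would then be
  1 or 3.\<close>

lemma cycle_edges_distance_two:
  assumes "distinct xs" "4 \<le> length xs" "i < length xs"
  shows "{xs ! i, xs ! ((i + 2) mod length xs)} \<notin> cycle_edges xs"
proof
  let ?L = "length xs"
  assume "{xs ! i, xs ! ((i + 2) mod ?L)} \<in> cycle_edges xs"
  then obtain m where m: "m < ?L" "{xs ! i, xs ! ((i + 2) mod ?L)} = {xs ! m, xs ! (Suc m mod ?L)}"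
    unfolding cycle_edges_def by blast
  have lt: "(i + 2) mod ?L < ?L" "Suc m mod ?L < ?L"
    using assms by (auto intro: mod_less_divisor)
  have "(i = m \<and> (i + 2) mod ?L = Suc m mod ?L) \<or> (i = Suc m mod ?L \<and> (i + 2) mod ?L = m)"
    using m lt assms nth_eq_iff_index_eq[OF assms(1)] by (auto simp: doubleton_eq_iff)
  then show False
    using assms m(1) by (auto simp: mod_if split: if_splits)
qed

text \<open>On a chordless cycle, vertices at distance two are not adjacent, so they are never both
  in \<open>K\<close>.\<close>

lemma split_graph_chordal:
  assumes clique: "\<And>a b. a \<in> K \<Longrightarrow> b \<in> K \<Longrightarrow> a \<noteq> b \<Longrightarrow> {a, b} \<in> E"
    and indep: "\<And>a b. a \<in> V - K \<Longrightarrow> b \<in> V - K \<Longrightarrow> {a, b} \<notin> E"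
  shows "chordal V E"
  unfolding chordal_def
proof
  assume "\<exists>xs. induced_cycle V E xs \<and> 4 \<le> length xs"
  then obtain xs where xs: "distinct xs" "set xs \<subseteq> V" "4 \<le> length xs"
    and eq: "{e \<in> E. e \<subseteq> set xs} = cycle_edges xs"
    unfolding induced_cycle_def by blast
  let ?L = "length xs"
  define s where "s i = Suc i mod ?L" for i
  have s_lt: "s i < ?L" for i
    using xs(3) by (auto simp: s_def intro: mod_less_divisor)
  have ss: "s (s i) = (i + 2) mod ?L" for i
    by (simp add: s_def mod_Suc_eq)
  have adj: "{xs ! i, xs ! s i} \<in> E" if "i < ?L" for i
    using that eq unfolding cycle_edges_def s_def by blast
  have nadj: "{xs ! i, xs ! s (s i)} \<notin> E" if "i < ?L" for i
    using cycle_edges_distance_two[OF xs(1,3) that] eq that s_lt unfolding ss[symmetric] by auto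
  have inV: "xs ! i \<in> V" if "i < ?L" for i
    using that xs(2) by auto
  have ne: "xs ! i \<noteq> xs ! s (s i)" if "i < ?L" for i
    using that s_lt nth_eq_iff_index_eq[OF xs(1)] xs(3) by (auto simp: ss mod_if split: if_splits)
  have not_both: "\<not> (xs ! i \<in> K \<and> xs ! s (s i) \<in> K)" if "i < ?L" for i
    using clique ne nadj that by blast
  \<comment> \<open>A cycle vertex outside the clique has both its neighbours in the clique,
    so they would be adjacent.\<close>
  have inK: "xs ! s i \<in> K" if "i < ?L" for i
    using not_both[OF that] indep adj[OF that] adj[OF s_lt] inV s_lt that by (meson DiffI)
  show False
    using not_both[OF s_lt] inK s_lt by blast
qed

text \<open>From fill-in to cover, chordality is used for 4-cycles only. \<open>card2\<close> keeps
  singletons out of \<open>E\<close>, which would violate the equation in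
  \<open>induced_cycle\<close>.\<close>

lemma chordal_four_cycle:
  assumes "chordal V E" and card2: "\<forall>e\<in>E. card e = 2"
    and dist: "distinct [a, b, c, d]" and sub: "{a, b, c, d} \<subseteq> V"
    and edges: "{a, b} \<in> E" "{b, c} \<in> E" "{c, d} \<in> E" "{d, a} \<in> E"
  shows "{a, c} \<in> E \<or> {b, d} \<in> E"
proof (rule ccontr)
  assume contra: "\<not> ?thesis"
  have ce: "cycle_edges [a, b, c, d] = {{a, b}, {b, c}, {c, d}, {d, a}}"
  proof -
    have "{i. i < length [a, b, c, d]} = {0, 1, 2, 3}" by auto
    moreover have "cycle_edges [a, b, c, d] =
      (\<lambda>i. {[a, b, c, d] ! i, [a, b, c, d] ! (Suc i mod length [a, b, c, d])}) `
        {i. i < length [a, b, c, d]}"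
      unfolding cycle_edges_def by blast
    ultimately have "cycle_edges [a, b, c, d] =
      (\<lambda>i. {[a, b, c, d] ! i, [a, b, c, d] ! (Suc i mod length [a, b, c, d])}) ` {0, 1, 2, 3}"
      by (simp only:)
    then show ?thesis by (simp add: nth_Cons')
  qed
  have "e \<in> {{a, b}, {b, c}, {c, d}, {d, a}}" if "e \<in> E" "e \<subseteq> {a, b, c, d}" for e
  proof -
    obtain x y where e: "e = {x, y}" "x \<noteq> y"
      using card2 \<open>e \<in> E\<close> by (meson card_2_iff)
    then have "x \<in> {a, b, c, d}" "y \<in> {a, b, c, d}" using that by auto
    moreover have "{a, c} \<notin> E" "{c, a} \<notin> E" "{b, d} \<notin> E" "{d, b} \<notin> E"
      using contra by (simp_all add: insert_commute)
    ultimately show ?thesis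
      using e \<open>e \<in> E\<close> by (elim insertE emptyE; simp add: doubleton_eq_iff)
  qed
  then have "{e \<in> E. e \<subseteq> set [a, b, c, d]} = cycle_edges [a, b, c, d]"
    unfolding ce using edges by auto
  then have "induced_cycle V E [a, b, c, d]"
    unfolding induced_cycle_def using dist sub by auto
  then show False
    using assms(1) unfolding chordal_def by force
qed


section \<open>The reduction\<close>

text \<open>The vertices below \<open>n\<close> carry the input graph, given by its adjacency relation \<open>A\<close>; the
  other \<open>n ^ 3\<close> vertices form a clique. The guards of vertex \<open>i < n\<close>, the only clique vertices
  not adjacent to it, are those congruent to \<open>i\<close> modulo \<open>n\<close>.\<close>

definition red_adj :: "(nat \<Rightarrow> nat \<Rightarrow> bool) \<Rightarrow> nat \<Rightarrow> nat \<Rightarrow> nat \<Rightarrow> bool" where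
  "red_adj A n a b \<longleftrightarrow>
     (if a < n \<and> b < n then A a b
      else if a < n \<or> b < n then a mod n \<noteq> b mod n
      else a \<noteq> b)"

definition red_edges :: "(nat \<Rightarrow> nat \<Rightarrow> bool) \<Rightarrow> nat \<Rightarrow> nat set set" where
  "red_edges A n = {{a, b} | a b. a < n ^ 3 + n \<and> b < n ^ 3 + n \<and> red_adj A n a b}"

definition guards :: "nat \<Rightarrow> nat \<Rightarrow> nat set" where
  "guards n i = {s. n \<le> s \<and> s < n ^ 3 + n \<and> s mod n = i}"

locale graph_adjacency =
  fixes A :: "nat \<Rightarrow> nat \<Rightarrow> bool" and n :: nat
  assumes A_sym: "\<And>i j. A i j \<Longrightarrow> A j i" and A_irrefl: "\<And>i. i < n \<Longrightarrow> \<not> A i i"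
    and n_pos: "n \<ge> 1"
begin

lemma red_adj_sym: "red_adj A n a b \<Longrightarrow> red_adj A n b a"
  using A_sym unfolding red_adj_def by (auto split: if_splits)

lemma red_adj_irrefl: "\<not> red_adj A n a a"
  using A_irrefl unfolding red_adj_def by auto

lemma red_edges_iff:
  assumes "a < n ^ 3 + n" "b < n ^ 3 + n"
  shows "{a, b} \<in> red_edges A n \<longleftrightarrow> red_adj A n a b"
proof
  assume "{a, b} \<in> red_edges A n"
  then obtain x y where "{a, b} = {x, y}" "red_adj A n x y"
    unfolding red_edges_def by blast
  then show "red_adj A n a b"
    using red_adj_sym by (auto simp: doubleton_eq_iff)
qed (use assms in \<open>auto simp: red_edges_def\<close>)

lemma simple_red: "simple_graph {..<n ^ 3 + n} (red_edges A n)"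
proof -
  have "card {a, b} = 2" if "red_adj A n a b" for a b
    using that red_adj_irrefl by (cases "a = b") auto
  then show ?thesis
    unfolding simple_graph_def red_edges_def by auto
qed

text \<open>Division by \<open>n\<close> gives the clique vertices quotients from 1 to
  \<open>n ^ 2\<close>; the guards of \<open>i\<close> have remainder \<open>i\<close>, one guard
  per quotient.\<close>

lemma guards_eq:
  assumes "i < n"
  shows "guards n i = (\<lambda>q. Suc q * n + i) ` {..<n ^ 2}"
proof
  show "(\<lambda>q. Suc q * n + i) ` {..<n ^ 2} \<subseteq> guards n i"
  proof
    fix s assume "s \<in> (\<lambda>q. Suc q * n + i) ` {..<n ^ 2}"
    then obtain q where q: "q < n ^ 2" "s = Suc q * n + i" by auto
    have "Suc q * n \<le> n ^ 2 * n" using q by (intro mult_right_mono) auto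
    then have "s < n ^ 3 + n" using q assms by (simp add: power3_eq_cube power2_eq_square)
    moreover have "s mod n = i" using q(2) assms by (metis mod_mult_self3 mod_less)
    ultimately show "s \<in> guards n i" using q(2) by (simp add: guards_def)
  qed
next
  show "guards n i \<subseteq> (\<lambda>q. Suc q * n + i) ` {..<n ^ 2}"
  proof
    fix s assume s: "s \<in> guards n i"
    then have lt: "s < (n ^ 2 + 1) * n" and ge: "n \<le> s" and md: "s mod n = i"
      by (auto simp: guards_def power3_eq_cube power2_eq_square)
    have "s div n < n ^ 2 + 1" using lt by (rule less_mult_imp_div_less)
    moreover have "s div n \<ge> 1" using ge n_pos by (simp add: div_greater_zero_iff Suc_leI)
    ultimately have "s div n - 1 < n ^ 2" "Suc (s div n - 1) = s div n" by auto
    moreover have "s = s div n * n + i" using md by (metis div_mult_mod_eq)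
    ultimately show "s \<in> (\<lambda>q. Suc q * n + i) ` {..<n ^ 2}"
      by (intro image_eqI[of _ _ "s div n - 1"]) (simp_all del: mult_Suc)
  qed
qed

lemma card_guards:
  assumes "i < n"
  shows "card (guards n i) = n ^ 2"
proof -
  have "inj_on (\<lambda>q. Suc q * n + i) {..<n ^ 2}"
    using n_pos by (auto simp: inj_on_def)
  then show ?thesis by (simp add: guards_eq[OF assms] card_image del: mult_Suc)
qed

lemma finite_guards: "finite (guards n i)"
  by (rule finite_subset[of _ "{..<n ^ 3 + n}"]) (auto simp: guards_def)

section \<open>Vertex covers and fill-ins\<close>

definition guard_edges :: "nat set \<Rightarrow> nat set set" where
  "guard_edges C = (\<lambda>(i, s). {i, s}) ` (SIGMA i:C. guards n i)"

text \<open>The end below \<open>n\<close> of such an edge is the guarded vertex, the other end its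
  guard. So different vertices share no guard edge and the counts add up.\<close>

lemma card_guard_edges:
  assumes "C \<subseteq> {..<n}"
  shows "card (guard_edges C) = card C * n ^ 2"
proof -
  have "inj_on (\<lambda>(i, s). {i, s}) (SIGMA i:C. guards n i)"
    using assms by (auto simp: inj_on_def guards_def doubleton_eq_iff)
  moreover have "finite C" using assms finite_subset by blast
  moreover have "(\<Sum>i\<in>C. card (guards n i)) = card C * n ^ 2"
    using assms card_guards by (simp add: subset_iff)
  ultimately show ?thesis
    unfolding guard_edges_def
    by (simp add: card_image card_SigmaI finite_guards)
qed

lemma cover_to_fill_in:
  assumes C: "C \<subseteq> {..<n}" and cov: "\<And>i j. i < n \<Longrightarrow> j < n \<Longrightarrow> A i j \<Longrightarrow> i \<in> C \<or> j \<in> C"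
  shows "\<exists>F. fill_in {..<n ^ 3 + n} (red_edges A n) F \<and> card F \<le> (card C + 1) * n ^ 2 - 1"
proof -
  let ?N = "n ^ 3 + n"
  let ?P = "{e. e \<subseteq> C \<and> card e = 2}"
  \<comment> \<open>Pairs inside \<open>C\<close> that are edges already are left out, as a fill-in
    consists of non-edges.\<close>
  define F where "F = guard_edges C \<union> (?P - red_edges A n)"
  have fC: "finite C" using C finite_subset by blast
  have fP: "finite ?P" using fC by simp
  have cC: "card C \<le> n" using card_mono[OF _ C] by simp
  \<comment> \<open>Beyond the guard edges there is room for \<open>n ^ 2 - 1\<close> more; bounding
    the pairs inside \<open>C\<close> without the factor one half suffices.\<close>
  have "card ?P = card C * (card C - 1) div 2"
    using n_subsets[OF fC, of 2] by (simp add: choose_two)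
  also have "\<dots> \<le> card C * (card C - 1)" by simp
  also have "\<dots> \<le> n * (n - 1)" using cC by (intro mult_le_mono) auto
  also have "\<dots> \<le> n ^ 2 - 1" using n_pos by (simp add: power2_eq_square diff_mult_distrib2)
  finally have "card (?P - red_edges A n) \<le> n ^ 2 - 1"
    using card_mono[OF fP, of "?P - red_edges A n"] by auto
  then have "card F \<le> card C * n ^ 2 + (n ^ 2 - 1)"
    unfolding F_def using card_Un_le[of "guard_edges C" "?P - red_edges A n"] card_guard_edges[OF C]
    by linarith
  \<comment> \<open>As \<open>n ^ 2\<close> is positive, the truncated subtractions are
    exact.\<close>
  then have card: "card F \<le> (card C + 1) * n ^ 2 - 1"
    using n_pos by (simp add: Nat.add_diff_assoc)
  have lt: "i < ?N" if "i < n" for i using that by linarith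
  have sub: "F \<subseteq> non_edges {..<?N} (red_edges A n)"
  proof
    fix e assume "e \<in> F"
    then consider i s where "e = {i, s}" "i \<in> C" "s \<in> guards n i" | "e \<in> ?P - red_edges A n"
      unfolding F_def guard_edges_def by auto
    then show "e \<in> non_edges {..<?N} (red_edges A n)"
    proof cases
      case 1
      then have *: "i < n" "n \<le> s" "s < ?N" "s mod n = i" using C by (auto simp: guards_def)
      then have "\<not> red_adj A n i s" "i \<noteq> s" by (auto simp: red_adj_def)
      then show ?thesis
        using * 1(1) red_edges_iff[of i s] lt by (simp add: non_edges_def)
    next
      case 2
      then show ?thesis using C lt by (auto simp: non_edges_def)
    qed
  qed
  have pairs: "e \<in> red_edges A n \<union> F" if "e \<subseteq> C" "card e = 2" for e
    using that unfolding F_def by blast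
  have mixed: "{a, b} \<in> red_edges A n \<union> F" if "a \<in> C" "b \<in> {n..<?N}" for a b
  proof (cases "b mod n = a")
    case True
    then show ?thesis using that unfolding F_def guard_edges_def guards_def by force
  next
    case False
    then have "red_adj A n a b" using that C by (auto simp: red_adj_def)
    then show ?thesis using that C lt red_edges_iff[of a b] by auto
  qed
  \<comment> \<open>The clique side consists of the cover and all guards. The remaining vertices
    avoid the cover, hence are independent.\<close>
  have "chordal {..<?N} (red_edges A n \<union> F)"
  proof (rule split_graph_chordal[where K = "C \<union> {n..<?N}"])
    fix a b assume ab: "a \<in> C \<union> {n..<?N}" "b \<in> C \<union> {n..<?N}" "a \<noteq> b"
    have "{a, b} \<in> red_edges A n" if "a \<in> {n..<?N}" "b \<in> {n..<?N}"
      using that ab red_edges_iff[of a b] by (auto simp: red_adj_def)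
    then show "{a, b} \<in> red_edges A n \<union> F"
      using ab pairs[of "{a, b}"] mixed[of a b] mixed[of b a] by (auto simp: insert_commute)
  next
    fix a b assume "a \<in> {..<?N} - (C \<union> {n..<?N})" "b \<in> {..<?N} - (C \<union> {n..<?N})"
    then have *: "a < n" "b < n" "a \<notin> C" "b \<notin> C" by auto
    then have "\<not> red_adj A n a b" using cov by (auto simp: red_adj_def)
    moreover have "{a, b} \<notin> F"
      using * unfolding F_def guard_edges_def by (auto simp: doubleton_eq_iff)
    ultimately show "{a, b} \<notin> red_edges A n \<union> F"
      using * lt red_edges_iff[of a b] by auto
  qed
  then show ?thesis using sub card unfolding fill_in_def by blast
qed

text \<open>Each vertex joined to all its guards uses up \<open>n ^ 2\<close> edges of
  \<open>F\<close>, so fewer than \<open>(c + 1) * n ^ 2\<close> edges allow at most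
  \<open>c\<close> such vertices.\<close>

lemma fill_in_to_cover:
  assumes fill: "fill_in {..<n ^ 3 + n} (red_edges A n) F" and F: "card F < (c + 1) * n ^ 2"
  shows "\<exists>C\<subseteq>{..<n}. card C \<le> c \<and> (\<forall>i<n. \<forall>j<n. A i j \<longrightarrow> i \<in> C \<or> j \<in> C)"
proof -
  let ?N = "n ^ 3 + n"
  define C where "C = {i. i < n \<and> (\<forall>s\<in>guards n i. {i, s} \<in> F)}"
  have CN: "C \<subseteq> {..<n}" by (auto simp: C_def)
  have Fsub: "F \<subseteq> {e. e \<subseteq> {..<?N} \<and> card e = 2}"
    using fill unfolding fill_in_def non_edges_def by auto
  then have "finite F" by (rule finite_subset) simp
  moreover have "guard_edges C \<subseteq> F" by (auto simp: C_def guard_edges_def)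
  ultimately have "card C * n ^ 2 \<le> card F"
    using card_mono card_guard_edges[OF CN] by metis
  then have "card C * n ^ 2 < (c + 1) * n ^ 2" using F by linarith
  then have "card C \<le> c" by (simp only: mult_less_cancel2) simp
  moreover have "i \<in> C \<or> j \<in> C" if ij: "i < n" "j < n" "A i j" for i j
  proof (rule ccontr)
    assume "\<not> (i \<in> C \<or> j \<in> C)"
    \<comment> \<open>Each end of the uncovered edge misses a guard. The chords of the 4-cycle
      \<open>i\<close>, \<open>j\<close>, \<open>s\<close>, \<open>t\<close> are the two missing
      edges, while \<open>j s\<close> and \<open>t i\<close> are edges because the remainders
      differ.\<close>
    then obtain s t where s: "s \<in> guards n i" "{i, s} \<notin> F" and t: "t \<in> guards n j" "{j, t} \<notin> F"
      using ij unfolding C_def by blast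
    have neq: "i \<noteq> j" using A_irrefl ij by blast
    have s': "n \<le> s" "s < ?N" "s mod n = i" and t': "n \<le> t" "t < ?N" "t mod n = j"
      using s t by (auto simp: guards_def)
    have st: "s \<noteq> t" using s' t' neq by blast
    have lt: "i < ?N" "j < ?N" using ij by auto
    have adj: "red_adj A n i j" "red_adj A n j s" "red_adj A n s t" "red_adj A n t i"
      and nadj: "\<not> red_adj A n i s" "\<not> red_adj A n j t"
      using ij s' t' neq st by (auto simp: red_adj_def)
    have "\<forall>e\<in>red_edges A n \<union> F. card e = 2"
      using simple_red Fsub unfolding simple_graph_def by auto
    moreover have "chordal {..<?N} (red_edges A n \<union> F)"
      using fill unfolding fill_in_def by blast
    moreover have "distinct [i, j, s, t]" using neq st ij s' t' by auto
    moreover have "{i, j, s, t} \<subseteq> {..<?N}" using lt s' t' by simp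
    moreover have "{i, j} \<in> red_edges A n" "{j, s} \<in> red_edges A n" "{s, t} \<in> red_edges A n"
      "{t, i} \<in> red_edges A n"
      using adj lt s'(2) t'(2) by (simp_all only: red_edges_iff)
    ultimately have "{i, s} \<in> red_edges A n \<union> F \<or> {j, t} \<in> red_edges A n \<union> F"
      by (intro chordal_four_cycle) (simp_all only: Un_iff simp_thms)
    then show False
      using s(2) t(2) nadj red_edges_iff lt s' t' by auto
  qed
  ultimately show ?thesis using CN by blast
qed

text \<open>A cover with fewer than \<open>c\<close> vertices can be padded to exactly
  \<open>c\<close>, as \<open>c \<le> n\<close> and supersets of covers are covers.\<close>

theorem cover_iff_fill_in:
  assumes "c \<le> n"
  shows "(\<exists>C\<subseteq>{..<n}. card C = c \<and> (\<forall>i<n. \<forall>j<n. A i j \<longrightarrow> i \<in> C \<or> j \<in> C)) \<longleftrightarrow>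
    (\<exists>F. fill_in {..<n ^ 3 + n} (red_edges A n) F \<and> card F \<le> (c + 1) * n ^ 2 - 1)"
    (is "?L \<longleftrightarrow> ?R")
proof
  assume ?L
  then show ?R using cover_to_fill_in by blast
next
  assume ?R
  then obtain F where F: "fill_in {..<n ^ 3 + n} (red_edges A n) F"
    and le: "card F \<le> (c + 1) * n ^ 2 - 1"
    by blast
  \<comment> \<open>With truncated subtraction, \<open>m \<le> k - 1\<close> gives
    \<open>m < k\<close> only for positive \<open>k\<close>.\<close>
  have pos: "(c + 1) * n ^ 2 > 0" using n_pos by simp
  have "m < k" if "m \<le> k - 1" "k > 0" for m k :: nat
    using that by linarith
  from fill_in_to_cover[OF F this[OF le pos]]
  obtain C where C: "C \<subseteq> {..<n}" "card C \<le> c" "\<forall>i<n. \<forall>j<n. A i j \<longrightarrow> i \<in> C \<or> j \<in> C"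
    by blast
  obtain D where D: "C \<subseteq> D" "D \<subseteq> {..<n}" "card D = c"
    using exists_subset_between[OF C(2) _ C(1)] assms by auto
  have "i \<in> D \<or> j \<in> D" if "i < n" "j < n" "A i j" for i j
    using C(3) that D(1) by auto
  then show ?L using D(2,3) by (intro exI[of _ D]) simp
qed

end


section \<open>Structured programs for the random access machine\<close>

text \<open>All loops test at the end: each compiles to one backward jump, and the program branches
  nowhere else.\<close>

datatype com =
    Instr instr
  | Seq com com  (infixr \<open>;;\<close> 60)
  | DoWhile com nat

fun com_size :: "com \<Rightarrow> nat" where
  "com_size (Instr i) = 1"
| "com_size (c ;; d) = com_size c + com_size d"
| "com_size (DoWhile c j) = Suc (com_size c)"

text \<open>Jump targets are absolute, hence the parameter \<open>l\<close>, the address of the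
  first instruction.\<close>

fun compile :: "nat \<Rightarrow> com \<Rightarrow> instr list" where
  "compile l (Instr i) = [i]"
| "compile l (c ;; d) = compile l c @ compile (l + com_size c) d"
| "compile l (DoWhile c j) = compile l c @ [JumpPos l j]"

lemma length_compile: "length (compile l c) = com_size c"
  by (induction c arbitrary: l) auto

type_synonym ram_store = "(nat \<Rightarrow> nat) \<times> nat list \<times> nat list"

fun config :: "nat \<Rightarrow> ram_store \<Rightarrow> ram_config" where
  "config l (R, I, U) = \<lparr>pc = l, reg = R, inp = I, outp = U\<rparr>"

definition runs :: "instr list \<Rightarrow> nat \<Rightarrow> ram_config \<Rightarrow> ram_config \<Rightarrow> bool" where
  "runs P T s s' \<longleftrightarrow> (\<exists>t\<le>T. (ram_step P ^^ t) s = s')"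

lemma runs_trans:
  assumes "runs P T s s'" "runs P T' s' s''"
  shows "runs P (T + T') s s''"
proof -
  obtain t t' where "t \<le> T" "t' \<le> T'" "(ram_step P ^^ t) s = s'" "(ram_step P ^^ t') s' = s''"
    using assms unfolding runs_def by blast
  moreover from this have "(ram_step P ^^ (t' + t)) s = s''" by (simp add: funpow_add)
  ultimately show ?thesis unfolding runs_def by (intro exI[of _ "t' + t"]) auto
qed

lemma runs_step: "runs P 1 s (ram_step P s)"
  unfolding runs_def by (intro exI[of _ 1]) simp

text \<open>The surrounding code is arbitrary, so that a piece may sit anywhere in a larger program;
  in a sequence each half is part of the context of the other.\<close>

definition computes :: "com \<Rightarrow> nat \<Rightarrow> ram_store \<Rightarrow> ram_store \<Rightarrow> bool" where
  "computes c T s s' \<longleftrightarrow>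
     (\<forall>Q Q'. runs (Q @ compile (length Q) c @ Q') T
        (config (length Q) s) (config (length Q + com_size c) s'))"

lemma computes_Seq:
  assumes "computes c T s s'" "computes d T' s' s''"
  shows "computes (c ;; d) (T + T') s s''"
  unfolding computes_def
proof (intro allI)
  fix Q Q'
  let ?P = "Q @ compile (length Q) (c ;; d) @ Q'"
  have "runs ?P T (config (length Q) s) (config (length Q + com_size c) s')"
    using assms(1)[unfolded computes_def, rule_format, of Q "compile (length Q + com_size c) d @ Q'"]
    by simp
  moreover have "runs ?P T' (config (length Q + com_size c) s')
      (config (length Q + com_size c + com_size d) s'')"
    using assms(2)[unfolded computes_def, rule_format, of "Q @ compile (length Q) c" Q']
    by (simp add: length_compile)
  ultimately show "runs ?P (T + T') (config (length Q) s) (config (length Q + com_size (c ;; d)) s'')"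
    using runs_trans by (fastforce simp: add.assoc)
qed

lemma computes_Instr:
  assumes "\<And>l. ram_exec i (config l s) = config (Suc l) s'"
  shows "computes (Instr i) 1 s s'"
  unfolding computes_def
proof (intro allI)
  fix Q Q'
  have "ram_step (Q @ compile (length Q) (Instr i) @ Q') (config (length Q) s) =
      config (length Q + com_size (Instr i)) s'"
    using assms[of "length Q"]
    by (cases s; cases s') (simp add: ram_step_def ram_halted_def nth_append)
  then show "runs (Q @ compile (length Q) (Instr i) @ Q') 1 (config (length Q) s)
      (config (length Q + com_size (Instr i)) s')"
    using runs_step by metis
qed

lemma computes_instrs:
  "computes (Instr (SetConst i k)) 1 (R, I, U) (R(i := k), I, U)"
  "computes (Instr (Add i j m)) 1 (R, I, U) (R(i := R j + R m), I, U)"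
  "computes (Instr (Sub i j m)) 1 (R, I, U) (R(i := R j - R m), I, U)"
  "computes (Instr (Read i)) 1 (R, x # I, U) (R(i := x), I, U)"
  "computes (Instr (Print i)) 1 (R, I, U) (R, I, U @ [R i])"
  by (rule computes_Instr; simp)+

text \<open>\<open>s j\<close> is the store after \<open>j\<close> rounds; its counter
  \<open>K - j\<close> first vanishes at \<open>j = K\<close>, where the jump falls through. The
  jump is the extra step of each round, and \<open>K \<ge> 1\<close> since the body precedes the
  test.\<close>

lemma computes_DoWhile:
  assumes body: "\<And>j. j < K \<Longrightarrow> computes c T (s j) (s (Suc j))"
    and ctr: "\<And>j. j \<le> K \<Longrightarrow> fst (s j) i = K - j" and "K \<ge> 1"
  shows "computes (DoWhile c i) (K * (T + 1)) (s 0) (s K)"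
  unfolding computes_def
proof (intro allI)
  fix Q Q'
  let ?P = "Q @ compile (length Q) (DoWhile c i) @ Q'"
  let ?l = "length Q"
  have iter: "runs ?P (T + 1) (config ?l (s j))
      (config (if Suc j = K then Suc (?l + com_size c) else ?l) (s (Suc j)))" if "j < K" for j
  proof -
    obtain R I U where sj: "s (Suc j) = (R, I, U)" using prod_cases3 by blast
    have "R i = K - Suc j" using ctr[of "Suc j"] that sj by simp
    then have "ram_step ?P (config (?l + com_size c) (s (Suc j))) =
        config (if Suc j = K then Suc (?l + com_size c) else ?l) (s (Suc j))"
      using that by (auto simp: sj ram_step_def ram_halted_def nth_append length_compile)
    then have "runs ?P 1 (config (?l + com_size c) (s (Suc j)))
        (config (if Suc j = K then Suc (?l + com_size c) else ?l) (s (Suc j)))"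
      using runs_step by metis
    moreover have "runs ?P T (config ?l (s j)) (config (?l + com_size c) (s (Suc j)))"
      using body[OF that, unfolded computes_def, rule_format, of Q "[JumpPos ?l i] @ Q'"] by simp
    ultimately show ?thesis using runs_trans by blast
  qed
  have "runs ?P (j * (T + 1)) (config ?l (s 0))
      (config (if j = K then Suc (?l + com_size c) else ?l) (s j))" if "j \<le> K" for j
    using that
  proof (induction j)
    case 0
    then show ?case using \<open>K \<ge> 1\<close> by (auto simp: runs_def)
  next
    case (Suc j)
    then have "runs ?P (j * (T + 1)) (config ?l (s 0)) (config ?l (s j))" by auto
    from runs_trans[OF this iter[of j]] Suc.prems show ?case
      by (simp add: algebra_simps)
  qed
  from this[of K] show "runs ?P (K * (T + 1)) (config ?l (s 0))
      (config (?l + com_size (DoWhile c i)) (s K))" by simp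
qed

text \<open>Registers 0 and 1 hold the constants 0 and 1. The loop counter \<open>i\<close> runs downwards from
  the value of register \<open>m\<close> to 1; the body is executed at least once.\<close>

definition For :: "nat \<Rightarrow> nat \<Rightarrow> com \<Rightarrow> com" where
  "For i m c = Instr (Add i m 0) ;; DoWhile (c ;; Instr (Sub i i 1)) i"

text \<open>The body must leave the counter alone. The two extra steps per round are decrement and
  jump; the single one copies register \<open>m\<close> by adding register 0.\<close>

lemma computes_For:
  assumes body: "\<And>j. j < K \<Longrightarrow>
      computes c T ((R j)(i := K - j), I j, U j) ((R (Suc j))(i := K - j), I (Suc j), U (Suc j))"
    and R: "R 0 m = K" "R 0 0 = 0" "\<And>j. j \<le> K \<Longrightarrow> R j 1 = 1" and "i \<noteq> 1" "K \<ge> 1"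
  shows "computes (For i m c) (1 + K * (T + 2)) (R 0, I 0, U 0) ((R K)(i := 0), I K, U K)"
proof -
  define s where "s j = ((R j)(i := K - j), I j, U j)" for j
  have "computes (c ;; Instr (Sub i i 1)) (T + 1) (s j) (s (Suc j))" if "j < K" for j
  proof (rule computes_Seq)
    show "computes c T (s j) ((R (Suc j))(i := K - j), I (Suc j), U (Suc j))"
      using body[OF that] by (simp add: s_def)
    show "computes (Instr (Sub i i 1)) 1 ((R (Suc j))(i := K - j), I (Suc j), U (Suc j)) (s (Suc j))"
      by (rule computes_Instr) (use that R(3)[of "Suc j"] \<open>i \<noteq> 1\<close> in \<open>simp add: s_def\<close>)
  qed
  then have "computes (DoWhile (c ;; Instr (Sub i i 1)) i) (K * (T + 1 + 1)) (s 0) (s K)"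
    by (rule computes_DoWhile) (use \<open>K \<ge> 1\<close> in \<open>auto simp: s_def\<close>)
  moreover have "computes (Instr (Add i m 0)) 1 (R 0, I 0, U 0) (s 0)"
    by (rule computes_Instr) (use R in \<open>simp add: s_def\<close>)
  ultimately show ?thesis
    unfolding For_def using computes_Seq by (fastforce simp: s_def)
qed

text \<open>A piece that restores all registers is described by the input it consumes and the output
  it adds, and these concatenate.\<close>

definition emits :: "com \<Rightarrow> nat \<Rightarrow> (nat \<Rightarrow> nat) \<Rightarrow> nat list \<Rightarrow> nat list \<Rightarrow> bool" where
  "emits c T R x y \<longleftrightarrow> (\<forall>I U. computes c T (R, x @ I, U) (R, I, U @ y))"

lemma emits_Seq:
  assumes "emits c T R x y" "emits d T' R x' y'"
  shows "emits (c ;; d) (T + T') R (x @ x') (y @ y')"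
  using assms computes_Seq unfolding emits_def by (metis append.assoc)

text \<open>The counter is 0 before and after the loop, so the loop restores the registers if its
  body does.\<close>

lemma emits_For:
  assumes body: "\<And>j. j < K \<Longrightarrow> emits c T (R(i := K - j)) (x j) (y j)"
    and R: "R m = K" "R 0 = 0" "R 1 = 1" "R i = 0" and "K \<ge> 1"
  shows "emits (For i m c) (1 + K * (T + 2)) R (concat (map x [0..<K])) (concat (map y [0..<K]))"
  unfolding emits_def
proof (intro allI)
  fix I U
  define In where "In j = concat (map x [j..<K]) @ I" for j
  define Out where "Out j = U @ concat (map y [0..<j])" for j
  have step: "computes c T (R(i := K - j), In j, Out j) (R(i := K - j), In (Suc j), Out (Suc j))"
    if "j < K" for j
    using body[OF that, unfolded emits_def, rule_format,
        of "concat (map x [Suc j..<K]) @ I" "U @ concat (map y [0..<j])"] that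
    by (simp add: In_def Out_def upt_conv_Cons)
  have "i \<noteq> 1" using R by auto
  from computes_For[of K c T "\<lambda>_. R" i In Out m, OF step R(1,2) R(3) this \<open>K \<ge> 1\<close>]
  show "computes (For i m c) (1 + K * (T + 2)) (R, concat (map x [0..<K]) @ I, U)
      (R, I, U @ concat (map y [0..<K]))"
    using R(4) by (simp add: In_def Out_def fun_upd_idem)
qed


section \<open>The program\<close>

text \<open>Comparison without branching: truncated differences in both directions add up to
  absolute differences, and subtracting from 1 twice turns every positive sum into 1. Registers 9
  and 10 are scratch.\<close>

definition print_distinct :: "nat \<Rightarrow> nat \<Rightarrow> nat \<Rightarrow> nat \<Rightarrow> com" where
  "print_distinct a b c d =
     Instr (Sub 9 a b) ;; Instr (Sub 10 b a) ;; Instr (Add 9 9 10) ;;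
     Instr (Sub 10 c d) ;; Instr (Add 9 9 10) ;; Instr (Sub 10 d c) ;; Instr (Add 9 9 10) ;;
     Instr (Sub 9 1 9) ;; Instr (Sub 9 1 9) ;; Instr (Print 9) ;;
     Instr (SetConst 9 0) ;; Instr (SetConst 10 0)"

lemma emits_print_distinct:
  assumes "{a, b, c, d} \<inter> {9, 10} = {}" "R 1 = 1" "R 9 = 0" "R 10 = 0"
  shows "emits (print_distinct a b c d) 12 R [] [if R a = R b \<and> R c = R d then 0 else 1]"
proof -
  define sto where "sto u v = R(9 := u, 10 := v)" for u v
  have subs: "computes (Instr (Sub 9 a b)) 1 (sto u v, I, U) (sto (R a - R b) v, I, U)"
    "computes (Instr (Sub 10 b a)) 1 (sto u v, I, U) (sto u (R b - R a), I, U)"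
    "computes (Instr (Sub 10 c d)) 1 (sto u v, I, U) (sto u (R c - R d), I, U)"
    "computes (Instr (Sub 10 d c)) 1 (sto u v, I, U) (sto u (R d - R c), I, U)"
    "computes (Instr (Sub 9 1 9)) 1 (sto u v, I, U) (sto (1 - u) v, I, U)"
    "computes (Instr (Add 9 9 10)) 1 (sto u v, I, U) (sto (u + v) v, I, U)"
    "computes (Instr (Print 9)) 1 (sto u v, I, U) (sto u v, I, U @ [u])"
    "computes (Instr (SetConst 9 0)) 1 (sto u v, I, U) (sto 0 v, I, U)"
    "computes (Instr (SetConst 10 0)) 1 (sto u v, I, U) (sto u 0, I, U)" for u v I U
    using assms by (auto intro!: computes_Instr simp: sto_def fun_upd_twist simp del: One_nat_def)
  have val: "1 - (1 - (x - y + (y - x) + (u - v) + (v - u))) =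
      (if x = y \<and> u = v then 0 else 1)" for x y u v :: nat
    by auto
  have "computes (print_distinct a b c d)
      (1 + (1 + (1 + (1 + (1 + (1 + (1 + (1 + (1 + (1 + (1 + 1)))))))))))
      (sto 0 0, I, U) (sto 0 0, I, U @ [if R a = R b \<and> R c = R d then 0 else 1])" for I U
    unfolding print_distinct_def val[symmetric]
    by (rule subs[THEN computes_Seq] subs(9))+
  moreover have "sto 0 0 = R" using assms by (simp add: sto_def fun_upd_idem)
  moreover have "1 + (1 + (1 + (1 + (1 + (1 + (1 + (1 + (1 + (1 + (1 + 1)))))))))) = (12 :: nat)"
    by simp
  ultimately show ?thesis by (simp only: emits_def append_Nil simp_thms)
qed

definition copy_number :: com where
  "copy_number = Instr (Read 9) ;; Instr (Print 9) ;; Instr (SetConst 9 0)"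

lemma emits_copy_number:
  assumes "R 9 = 0"
  shows "emits copy_number 3 R [x] [x]"
proof -
  have "computes copy_number (1 + (1 + 1)) (R, x # I, U) (R, I, U @ [x])" for I U
  proof -
    have "R(9 := x, 9 := 0) = R" using assms by (simp add: fun_upd_idem)
    then show ?thesis unfolding copy_number_def
      using computes_Seq[OF computes_instrs(4)[of 9 R x I U]
        computes_Seq[OF computes_instrs(5)[of 9] computes_instrs(1)[of 9 0]]] by simp
  qed
  then show ?thesis by (simp add: emits_def numeral_3_eq_3)
qed

text \<open>Registers: 2 holds \<open>n\<close>, 3 holds \<open>n ^ 2\<close>, 4 holds \<open>n ^ 3 + n\<close>. The vertex \<open>q * n + r\<close> is
  represented by the loop counters \<open>n ^ 2 + 1 - q\<close> (if \<open>q > 0\<close>) and \<open>n - r\<close>; registers 5 and 6 are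
  for the row, registers 7 and 8 for the column. The input matrix is the top left block of the
  output, hence its entries are copied as they are read.\<close>

definition arith_prog :: com where
  "arith_prog = Instr (SetConst 1 1) ;; Instr (Read 2) ;;
     For 5 2 (Instr (Add 3 3 2)) ;; Instr (Add 4 2 0) ;; For 5 2 (Instr (Add 4 4 3)) ;;
     Instr (Print 4)"

text \<open>Comparing register 0 with itself leaves only the comparison of remainders, which decides
  adjacency between the input vertices and the clique.\<close>

definition core_rows :: com where
  "core_rows = For 6 2 (For 8 2 copy_number ;; For 7 3 (For 8 2 (print_distinct 0 0 6 8)))"

definition clique_rows :: com where
  "clique_rows = For 5 3 (For 6 2
     (For 8 2 (print_distinct 0 0 6 8) ;; For 7 3 (For 8 2 (print_distinct 5 7 6 8))))"

definition red_prog :: com where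
  "red_prog = arith_prog ;; core_rows ;; clique_rows"

definition start_regs :: "nat \<Rightarrow> nat \<Rightarrow> nat" where
  "start_regs n = (\<lambda>_. 0)(1 := 1, 2 := n, 3 := n ^ 2, 4 := n ^ 3 + n)"

text \<open>Without multiplication, \<open>n ^ 2\<close> and \<open>n ^ 3 + n\<close> arise by
  repeated addition in \<open>n\<close> rounds each.\<close>

lemma computes_arith_prog:
  assumes "n \<ge> 1"
  shows "computes arith_prog (6 + 6 * n) (\<lambda>_. 0, n # I, []) (start_regs n, I, [n ^ 3 + n])"
proof -
  define sto where "sto u v = (\<lambda>_ :: nat. 0 :: nat)(1 := 1, 2 := n, 3 := u, 4 := v)" for u v
  have for3: "computes (For 5 2 (Instr (Add 3 3 2))) (1 + n * (1 + 2))
      (sto (0 * n) 0, I, U) ((sto (n * n) 0)(5 := 0), I, U)" for U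
    by (rule computes_For[where R = "\<lambda>j. sto (j * n) 0" and I = "\<lambda>_. I" and U = "\<lambda>_. U"])
      (use assms in \<open>auto intro!: computes_Instr simp: sto_def fun_eq_iff simp del: One_nat_def\<close>)
  have for4: "computes (For 5 2 (Instr (Add 4 4 3))) (1 + n * (1 + 2))
      (sto (n * n) (n + 0 * (n * n)), I, U) ((sto (n * n) (n + n * (n * n)))(5 := 0), I, U)" for U
    by (rule computes_For[where R = "\<lambda>j. sto (n * n) (n + j * (n * n))" and I = "\<lambda>_. I" and U = "\<lambda>_. U"])
      (use assms in \<open>auto intro!: computes_Instr simp: sto_def fun_eq_iff simp del: One_nat_def\<close>)
  \<comment> \<open>The counter ends at 0, its value before the loop.\<close>
  have five: "(sto u v)(5 := 0) = sto u v" for u v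
    by (auto simp: sto_def fun_eq_iff)
  have init: "computes (Instr (SetConst 1 1)) 1 (\<lambda>_. 0, n # I, []) ((\<lambda>_. 0)(1 := 1), n # I, [])"
    "computes (Instr (Read 2)) 1 ((\<lambda>_. 0)(1 := 1), n # I, []) (sto 0 0, I, [])"
    "computes (Instr (Add 4 2 0)) 1 (sto (n * n) 0, I, []) (sto (n * n) n, I, [])"
    "computes (Instr (Print 4)) 1 (sto (n * n) (n + n * (n * n)), I, [])
      (sto (n * n) (n + n * (n * n)), I, [n + n * (n * n)])"
    by (auto intro!: computes_Instr simp: sto_def fun_eq_iff simp del: One_nat_def)
  have "computes arith_prog (1 + (1 + ((1 + n * (1 + 2)) + (1 + ((1 + n * (1 + 2)) + 1)))))
      (\<lambda>_. 0, n # I, []) (sto (n * n) (n + n * (n * n)), I, [n + n * (n * n)])"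
    unfolding arith_prog_def
    using computes_Seq[OF init(1) computes_Seq[OF init(2) computes_Seq[OF
      for3[of "[]", unfolded five mult_0] computes_Seq[OF init(3)
      computes_Seq[OF for4[of "[]", unfolded five mult_0 add_0_right] init(4)]]]]] .
  moreover have "sto (n * n) (n + n * (n * n)) = start_regs n"
    by (simp add: sto_def start_regs_def power2_eq_square power3_eq_cube algebra_simps)
  moreover have "n + n * (n * n) = n ^ 3 + n" by (simp add: power3_eq_cube)
  moreover have "1 + (1 + ((1 + n * (1 + 2)) + (1 + ((1 + n * (1 + 2)) + 1)))) = 6 + 6 * n" by simp
  ultimately show ?thesis by (simp only:)
qed

section \<open>Printing the rows of the matrix\<close>

lemma concat_map_Nil: "concat (map (\<lambda>_. []) xs) = []"
  by (induction xs) auto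

text \<open>The counters run downwards, but for \<open>r\<close> and \<open>r'\<close> below
  \<open>n\<close> the numbers \<open>n - r\<close> and \<open>n - r'\<close> agree only if
  \<open>r = r'\<close>.\<close>

lemma emits_distinct_block:
  assumes "R 0 = 0" "R 1 = 1" "R 2 = n" "R 8 = 0" "R 9 = 0" "R 10 = 0" "R 6 = n - r" "r < n"
    and "{a, c} \<inter> {8, 9, 10} = {}"
  shows "emits (For 8 2 (print_distinct a c 6 8)) (1 + n * (12 + 2)) R []
    (map (\<lambda>r'. if R a = R c \<and> r = r' then 0 else 1) [0..<n])"
proof -
  have "emits (print_distinct a c 6 8) 12 (R(8 := n - r')) []
      [if R a = R c \<and> r = r' then 0 else 1]" if "r' < n" for r'
  proof -
    have "n - r = n - r' \<longleftrightarrow> r = r'" using that assms(8) by auto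
    then show ?thesis
      using emits_print_distinct[of a c 6 8 "R(8 := n - r')"] assms by simp
  qed
  then have "emits (For 8 2 (print_distinct a c 6 8)) (1 + n * (12 + 2)) R
      (concat (map (\<lambda>_. []) [0..<n]))
      (concat (map (\<lambda>r'. [if R a = R c \<and> r = r' then 0 else 1]) [0..<n]))"
    by (rule emits_For) (use assms in auto)
  then show ?thesis by (simp add: concat_map_Nil)
qed

text \<open>The bound mirrors the loops: 3 steps per copied entry, 12 per computed entry, 2 more per
  round, 1 per loop entry. \<open>f\<close> is arbitrary since copied entries are never
  inspected.\<close>

lemma emits_core_rows:
  assumes "n \<ge> 1"
  shows "emits core_rows
    (1 + n * ((1 + n * (3 + 2)) + (1 + n ^ 2 * ((1 + n * (12 + 2)) + 2)) + 2)) (start_regs n)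
    (concat (map (\<lambda>r. map (f r) [0..<n]) [0..<n]))
    (concat (map (\<lambda>r. map (f r) [0..<n] @
       concat (map (\<lambda>q'. map (\<lambda>r'. if r = r' then 0 else 1) [0..<n]) [0..<n ^ 2])) [0..<n]))"
  unfolding core_rows_def
proof (rule emits_For)
  fix r assume "r < n"
  let ?R = "(start_regs n)(6 := n - r)"
  have copy: "emits (For 8 2 copy_number) (1 + n * (3 + 2)) ?R
      (concat (map (\<lambda>r'. [f r r']) [0..<n])) (concat (map (\<lambda>r'. [f r r']) [0..<n]))"
    by (rule emits_For, rule emits_copy_number) (use assms in \<open>auto simp: start_regs_def\<close>)
  have "emits (For 7 3 (For 8 2 (print_distinct 0 0 6 8)))
      (1 + n ^ 2 * ((1 + n * (12 + 2)) + 2)) ?R (concat (map (\<lambda>_. []) [0..<n ^ 2]))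
      (concat (map (\<lambda>q'. map (\<lambda>r'. if ?R 0 = ?R 0 \<and> r = r' then 0 else 1) [0..<n]) [0..<n ^ 2]))"
  proof (rule emits_For)
    fix q' assume "q' < n ^ 2"
    show "emits (For 8 2 (print_distinct 0 0 6 8)) (1 + n * (12 + 2)) (?R(7 := n ^ 2 - q')) []
        (map (\<lambda>r'. if ?R 0 = ?R 0 \<and> r = r' then 0 else 1) [0..<n])"
      using emits_distinct_block[of "?R(7 := n ^ 2 - q')" n r 0 0] \<open>r < n\<close>
      by (simp add: start_regs_def)
  qed (use assms in \<open>auto simp: start_regs_def\<close>)
  from emits_Seq[OF copy this] show "emits (For 8 2 copy_number ;; For 7 3 (For 8 2 (print_distinct 0 0 6 8)))
      ((1 + n * (3 + 2)) + (1 + n ^ 2 * ((1 + n * (12 + 2)) + 2))) ?R (map (f r) [0..<n])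
      (map (f r) [0..<n] @
        concat (map (\<lambda>q'. map (\<lambda>r'. if r = r' then 0 else 1) [0..<n]) [0..<n ^ 2]))"
    by (simp add: concat_map_Nil)
qed (use assms in \<open>auto simp: start_regs_def\<close>)

lemma emits_clique_rows:
  assumes "n \<ge> 1"
  shows "emits clique_rows
    (1 + n ^ 2 * ((1 + n * ((1 + n * (12 + 2)) + (1 + n ^ 2 * ((1 + n * (12 + 2)) + 2)) + 2)) + 2))
    (start_regs n) []
    (concat (map (\<lambda>q. concat (map (\<lambda>r. map (\<lambda>r'. if r = r' then 0 else 1) [0..<n] @
       concat (map (\<lambda>q'. map (\<lambda>r'. if q = q' \<and> r = r' then 0 else 1) [0..<n]) [0..<n ^ 2]))
       [0..<n])) [0..<n ^ 2]))"
proof -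
  let ?block = "\<lambda>q r. map (\<lambda>r'. if r = r' then 0 else 1) [0..<n] @
    concat (map (\<lambda>q'. map (\<lambda>r'. if q = q' \<and> r = r' then 0 else 1) [0..<n]) [0..<n ^ 2])"
  have block: "emits (For 8 2 (print_distinct 0 0 6 8) ;; For 7 3 (For 8 2 (print_distinct 5 7 6 8)))
      ((1 + n * (12 + 2)) + (1 + n ^ 2 * ((1 + n * (12 + 2)) + 2)))
      ((start_regs n)(5 := n ^ 2 - q, 6 := n - r)) [] (?block q r)"
    if q: "q < n ^ 2" and r: "r < n" for q r
  proof -
    let ?R = "(start_regs n)(5 := n ^ 2 - q, 6 := n - r)"
    have core: "emits (For 8 2 (print_distinct 0 0 6 8)) (1 + n * (12 + 2)) ?R []
        (map (\<lambda>r'. if r = r' then 0 else 1) [0..<n])"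
      using emits_distinct_block[of ?R n r 0 0] r by (simp add: start_regs_def)
    have "emits (For 7 3 (For 8 2 (print_distinct 5 7 6 8)))
        (1 + n ^ 2 * ((1 + n * (12 + 2)) + 2)) ?R (concat (map (\<lambda>_. []) [0..<n ^ 2]))
        (concat (map (\<lambda>q'. map (\<lambda>r'. if q = q' \<and> r = r' then 0 else 1) [0..<n]) [0..<n ^ 2]))"
    proof (rule emits_For)
      fix q' assume "q' < n ^ 2"
      then have "n ^ 2 - q = n ^ 2 - q' \<longleftrightarrow> q = q'" using q by auto
      then show "emits (For 8 2 (print_distinct 5 7 6 8)) (1 + n * (12 + 2)) (?R(7 := n ^ 2 - q')) []
          (map (\<lambda>r'. if q = q' \<and> r = r' then 0 else 1) [0..<n])"
        using emits_distinct_block[of "?R(7 := n ^ 2 - q')" n r 5 7] r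
        by (simp add: start_regs_def)
    qed (use assms in \<open>auto simp: start_regs_def\<close>)
    from emits_Seq[OF core this] show ?thesis by (simp add: concat_map_Nil)
  qed
  have "emits clique_rows
    (1 + n ^ 2 * ((1 + n * ((1 + n * (12 + 2)) + (1 + n ^ 2 * ((1 + n * (12 + 2)) + 2)) + 2)) + 2))
    (start_regs n) (concat (map (\<lambda>q. concat (map (\<lambda>r. []) [0..<n])) [0..<n ^ 2]))
    (concat (map (\<lambda>q. concat (map (?block q) [0..<n])) [0..<n ^ 2]))"
    unfolding clique_rows_def
    by (rule emits_For, rule emits_For, rule block) (use assms in \<open>auto simp: start_regs_def\<close>)
  moreover have "concat (map (\<lambda>q. concat (map (\<lambda>r. []) [0..<n])) [0..<n ^ 2]) = ([] :: nat list)"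
    by simp
  ultimately show ?thesis by (simp only:)
qed

section \<open>The adjacency matrix in blocks\<close>

lemma concat_concat: "concat (concat xss) = concat (map concat xss)"
  by (induction xss) auto

lemma map_conv_map_nth: "map f xs = map (\<lambda>i. f (xs ! i)) [0..<length xs]"
  by (auto intro: nth_equalityI)

lemma upt_blocks: "[0..<k * n] = concat (map (\<lambda>q. map (\<lambda>r. q * n + r) [0..<n]) [0..<k])"
proof (induction k)
  case (Suc k)
  have "[0..<Suc k * n] = [0..<k * n] @ [k * n..<k * n + n]"
    using upt_add_eq_append[of 0 "k * n" n] by (simp add: add.commute)
  then show ?case using Suc map_add_upt[of "k * n" n] by (simp add: add.commute)
qed simp

text \<open>This is the order in which the loops visit the vertices: quotient 0 for the input graph,
  then the quotients \<open>Suc q\<close> for the clique.\<close>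

lemma upt_vertices:
  "[0..<n ^ 3 + n] = [0..<n] @ concat (map (\<lambda>q. map (\<lambda>r. Suc q * n + r) [0..<n]) [0..<n ^ 2])"
proof -
  have "[0..<n ^ 3 + n] = [0..<Suc (n ^ 2) * n]"
    by (simp add: power3_eq_cube power2_eq_square add.commute)
  moreover have "[0..<Suc k] = 0 # map Suc [0..<k]" for k
    by (simp add: map_Suc_upt upt_conv_Cons del: upt_Suc)
  moreover have "map ((+) 0) xs = xs" for xs :: "nat list"
    by (simp add: map_idI)
  ultimately show ?thesis
    by (simp add: upt_blocks comp_def del: upt_Suc mult_Suc)
qed

text \<open>Split by quotients, the matrix takes the form in which it is printed: a block of
  \<open>red_adj\<close> is either \<open>A\<close> or a comparison of remainders, together with
  quotients inside the clique.\<close>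

lemma (in graph_adjacency) red_encoding:
  "graph_encoding [0..<n ^ 3 + n] (red_edges A n) = (n ^ 3 + n) #
     concat (map (\<lambda>r. map (\<lambda>r'. if A r r' then 1 else 0) [0..<n] @
       concat (map (\<lambda>q'. map (\<lambda>r'. if r = r' then 0 else 1) [0..<n]) [0..<n ^ 2])) [0..<n]) @
     concat (map (\<lambda>q. concat (map (\<lambda>r. map (\<lambda>r'. if r = r' then 0 else 1) [0..<n] @
       concat (map (\<lambda>q'. map (\<lambda>r'. if q = q' \<and> r = r' then 0 else 1) [0..<n]) [0..<n ^ 2]))
       [0..<n])) [0..<n ^ 2])"
proof -
  let ?N = "n ^ 3 + n"
  let ?e = "\<lambda>a b. if red_adj A n a b then 1 else 0 :: nat"
  have ge: "\<not> Suc q * n + r < n" for q r by simp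
  have inj: "Suc q * n + r = Suc q' * n + r' \<longleftrightarrow> q = q' \<and> r = r'" if "r < n" "r' < n" for q q' r r'
  proof
    assume "Suc q * n + r = Suc q' * n + r'"
    then have "(Suc q * n + r) div n = (Suc q' * n + r') div n"
      "(Suc q * n + r) mod n = (Suc q' * n + r') mod n" by (simp_all only:)
    then show "q = q' \<and> r = r'" using that by (simp del: mult_Suc)
  qed simp
  have row: "map (?e a) [0..<?N] = map (?e a) [0..<n] @
      concat (map (\<lambda>q. map (\<lambda>r. ?e a (Suc q * n + r)) [0..<n]) [0..<n ^ 2])" for a
    unfolding upt_vertices by (simp add: map_concat comp_def del: mult_Suc)
  have "graph_encoding [0..<?N] (red_edges A n) = ?N # concat (map (\<lambda>a. map (?e a) [0..<?N]) [0..<?N])"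
    unfolding graph_encoding_def by (auto simp: red_edges_iff intro!: arg_cong[of _ _ concat] map_cong)
  also have "\<dots> = ?N # concat (map (\<lambda>a. map (?e a) [0..<?N]) [0..<n]) @
      concat (map (\<lambda>q. concat (map (\<lambda>r. map (?e (Suc q * n + r)) [0..<?N]) [0..<n])) [0..<n ^ 2])"
    by (subst (2) upt_vertices) (simp add: map_concat comp_def concat_concat del: mult_Suc)
  finally show ?thesis
    unfolding row
    by (auto simp: red_adj_def ge inj simp del: mult_Suc intro!: arg_cong2[of _ _ _ _ append] arg_cong[of _ _ concat] map_cong)
qed

text \<open>\<open>ram_outputs_within\<close> inspects the configuration after exactly
  \<open>T\<close> steps; a machine that halts earlier no longer changes.\<close>

lemma ram_outputs_within_computes:
  assumes "computes c T (\<lambda>_. 0, x, []) (R, I, y)"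
  shows "ram_outputs_within (compile 0 c) x T y"
proof -
  let ?P = "compile 0 c" and ?f = "config (com_size c) (R, I, y)"
  obtain t where t: "t \<le> T" "(ram_step ?P ^^ t) (ram_init x) = ?f"
    using assms[unfolded computes_def, rule_format, of "[]" "[]"]
    by (auto simp: runs_def ram_init_def)
  have halted: "ram_halted ?P ?f" by (simp add: ram_halted_def length_compile)
  then have "(ram_step ?P ^^ k) ?f = ?f" for k
    by (induction k) (simp_all add: ram_step_def)
  then have "(ram_step ?P ^^ (T - t + t)) (ram_init x) = ?f"
    using t(2) by (simp only: funpow_add comp_def)
  then show ?thesis using t(1) halted by (simp add: ram_outputs_within_def)
qed

text \<open>Polymorphic so that one term is both a number at \<open>n\<close> and, at the variable
  \<open>[:0, 1:]\<close>, the polynomial bounding the time. Its degree is 6, like that of the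
  number of matrix entries.\<close>

definition red_time :: "'a::comm_semiring_1 \<Rightarrow> 'a" where
  "red_time n = 6 + 6 * n +
     ((1 + n * ((1 + n * (3 + 2)) + (1 + n ^ 2 * ((1 + n * (12 + 2)) + 2)) + 2)) +
      (1 + n ^ 2 * ((1 + n * ((1 + n * (12 + 2)) + (1 + n ^ 2 * ((1 + n * (12 + 2)) + 2)) + 2)) + 2)))"

lemma poly_red_time: "poly (red_time [:0, 1:]) n = red_time (n :: nat)"
  by (simp add: red_time_def)

lemma (in graph_adjacency) red_prog_correct:
  "ram_outputs_within (compile 0 red_prog)
     (n # concat (map (\<lambda>r. map (\<lambda>r'. if A r r' then 1 else 0) [0..<n]) [0..<n])) (red_time n)
     (graph_encoding [0..<n ^ 3 + n] (red_edges A n))"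
proof (rule ram_outputs_within_computes)
  note rows = emits_Seq[OF emits_core_rows[OF n_pos, of "\<lambda>r r'. if A r r' then 1 else 0"]
    emits_clique_rows[OF n_pos], unfolded append_Nil2]
  show "computes red_prog (red_time n)
      (\<lambda>_. 0, n # concat (map (\<lambda>r. map (\<lambda>r'. if A r r' then 1 else 0) [0..<n]) [0..<n]), [])
      (start_regs n, [], graph_encoding [0..<n ^ 3 + n] (red_edges A n))"
    unfolding red_prog_def red_time_def red_encoding
    using computes_Seq[OF computes_arith_prog[OF n_pos]
      rows[unfolded emits_def, rule_format, of "[]" "[n ^ 3 + n]"]]
    unfolding append_Nil2 append_Cons append_Nil .
qed

section \<open>Graphs on arbitrary vertex sets\<close>

theorem theorem1p4:
  "\<exists>(P :: instr list) (p :: nat poly).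
     \<forall>(V :: 'a set) E vs n.
       simple_graph V E \<and> card V = n \<and> n \<ge> 1 \<and> distinct vs \<and> set vs = V \<longrightarrow>
       (\<exists>E\<^sub>H.
          simple_graph {..<n ^ 3 + n} E\<^sub>H \<and>
          ram_outputs_within P (graph_encoding vs E) (poly p n)
            (graph_encoding [0..<n ^ 3 + n] E\<^sub>H) \<and>
          (\<forall>c\<le>n.
             (\<exists>C. vertex_cover V E C \<and> card C = c) \<longleftrightarrow>
             (\<exists>F. fill_in {..<n ^ 3 + n} E\<^sub>H F \<and> card F \<le> (c + 1) * n ^ 2 - 1)))"
proof (rule exI[of _ "compile 0 red_prog"], rule exI[of _ "red_time [:0, 1:]"], intro allI impI)
  fix V :: "'a set" and E vs n
  assume "simple_graph V E \<and> card V = n \<and> n \<ge> 1 \<and> distinct vs \<and> set vs = V"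
  then have E: "\<And>e. e \<in> E \<Longrightarrow> e \<subseteq> V \<and> card e = 2" and n: "n \<ge> 1"
    and vs: "distinct vs" "set vs = V" "length vs = n"
    using distinct_card[of vs] by (auto simp: simple_graph_def)
  \<comment> \<open>Vertices are replaced by their positions in \<open>vs\<close>.\<close>
  define A where "A i j \<longleftrightarrow> {vs ! i, vs ! j} \<in> E" for i j
  interpret graph_adjacency A n
  proof
    show "A j i" if "A i j" for i j using that by (simp add: A_def insert_commute)
    show "\<not> A i i" for i using E[of "{vs ! i}"] by (auto simp: A_def)
  qed (fact n)
  have bij: "bij_betw ((!) vs) {..<n} V"
    using bij_betw_nth[OF vs(1) refl vs(2)[symmetric]] vs(3) by simp
  have enc: "graph_encoding vs E =
      n # concat (map (\<lambda>r. map (\<lambda>r'. if A r r' then 1 else 0) [0..<n]) [0..<n])"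
    unfolding graph_encoding_def A_def
    by (simp add: map_conv_map_nth[of _ vs] vs(3))
  have covers: "(\<exists>C. vertex_cover V E C \<and> card C = c) \<longleftrightarrow>
      (\<exists>D\<subseteq>{..<n}. card D = c \<and> (\<forall>i<n. \<forall>j<n. A i j \<longrightarrow> i \<in> D \<or> j \<in> D))" (is "?L \<longleftrightarrow> ?R") for c
  proof
    assume ?L
    then obtain C where C: "C \<subseteq> V" "\<forall>e\<in>E. e \<inter> C \<noteq> {}" "card C = c"
      unfolding vertex_cover_def by blast
    \<comment> \<open>On positions below \<open>n\<close> the list is injective, so passing to the
      preimage of \<open>C\<close> keeps its size.\<close>
    define D where "D = {i. i < n \<and> vs ! i \<in> C}"
    have Dn: "D \<subseteq> {..<n}" by (auto simp: D_def)
    have "(!) vs ` D = C"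
      using C(1) bij unfolding D_def bij_betw_def by auto
    then have cardD: "card D = c"
      using C(3) bij Dn unfolding bij_betw_def by (metis card_image inj_on_subset)
    have "i \<in> D \<or> j \<in> D" if "i < n" "j < n" "A i j" for i j
    proof -
      have "{vs ! i, vs ! j} \<inter> C \<noteq> {}" using bspec[OF C(2)] that(3) unfolding A_def .
      then show ?thesis using that by (auto simp: D_def)
    qed
    then show ?R using Dn cardD by (intro exI[of _ D]) simp
  next
    assume ?R
    then obtain D where D: "D \<subseteq> {..<n}" "card D = c" "\<forall>i<n. \<forall>j<n. A i j \<longrightarrow> i \<in> D \<or> j \<in> D"
      by blast
    have "e \<inter> (!) vs ` D \<noteq> {}" if eE: "e \<in> E" for e
    proof -
      obtain u v where e: "e = {u, v}" "u \<in> V" "v \<in> V"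
        using E[OF eE] by (auto simp: card_2_iff)
      then obtain i j where "i < n" "j < n" "u = vs ! i" "v = vs ! j"
        using vs by (metis in_set_conv_nth)
      then show ?thesis using D(3) e(1) eE by (auto simp: A_def)
    qed
    moreover have "(!) vs ` D \<subseteq> V" "card ((!) vs ` D) = c"
      using D(1,2) bij unfolding bij_betw_def by (auto simp: card_image inj_on_subset)
    ultimately show ?L unfolding vertex_cover_def by blast
  qed
  show "\<exists>E\<^sub>H. simple_graph {..<n ^ 3 + n} E\<^sub>H \<and>
      ram_outputs_within (compile 0 red_prog) (graph_encoding vs E) (poly (red_time [:0, 1:]) n)
        (graph_encoding [0..<n ^ 3 + n] E\<^sub>H) \<and>
      (\<forall>c\<le>n. (\<exists>C. vertex_cover V E C \<and> card C = c) \<longleftrightarrow>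
         (\<exists>F. fill_in {..<n ^ 3 + n} E\<^sub>H F \<and> card F \<le> (c + 1) * n ^ 2 - 1))"
    using simple_red red_prog_correct cover_iff_fill_in unfolding enc covers poly_red_time
    by blast
qed

end
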